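(* Let $\mathcal{F}$ be a biatomic atomistic closure system over $X$. If for every $x \in X$ every minimal generator $A_x$ of $x$ is independent, then $c(\mathcal{F}) \leq \lceil \log_2(|X| + 1) \rceil$.
   Context: A closure system $\mathcal{F}$ over a finite set $X$ is a family of subsets of $X$ containing $X$ and closed under intersection; its members are called closed sets, and its closure operator is $\phi(Y) = \bigcap\{F \in \mathcal{F} \mid Y \subseteq F\}$. Write $\phi(x)$ for $\phi(\{x\})$ and $\phi(xy)$ for $\phi(\{x,y\})$. Closure systems are assumed standard: $\phi(\emptyset) = \emptyset$ and $\phi(x) \setminus \{x\}$ is closed for every $x \in X$. $\mathcal{F}$ is atomistic if $\phi(x) = \{x\}$ for every $x \in X$ (so the atoms, i.e. the closed sets covering $\emptyset$, are exactly the singletons). $\mathcal{F}$ is biatomic if for all non-empty closed sets $F_1, F_2 \in \mathcal{F}$ and every atom $\{x\} \in \mathcal{F}$, $x \in \phi(F_1 \cup F_2)$ implies that there exist atoms $\{x_1\} \subseteq F_1$ and $\{x_2\} \subseteq F_2$ such that $x \in \phi(x_1 x_2)$. A minimal generator of $x \in X$ is an inclusion-wise minimal subset $A_x \subseteq X$ such that $x \in \phi(A_x)$ (in particular $\{x\}$ counts as a trivial minimal generator of $x$). A subset $Y \subseteq X$ is independent if $\phi(Y_1 \cap Y_2) = \phi(Y_1) \cap \phi(Y_2)$ for all $Y_1, Y_2 \subseteq Y$. The Carathéodory number $c(\mathcal{F})$ is the least integer $k$ such that for all $A \subseteq X$ and $x \in X$, $x \in \phi(A)$ implies that there is $A' \subseteq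 A$ with $|A'| \leq k$ and $x \in \phi(A')$. *)

theory Defs
  imports Complex_Main
begin

definition closure_system :: "'a set \<Rightarrow> 'a set set \<Rightarrow> bool" where
  "closure_system X \<F> \<longleftrightarrow>
     \<F> \<subseteq> Pow X \<and> X \<in> \<F> \<and> (\<forall>A\<in>\<F>. \<forall>B\<in>\<F>. A \<inter> B \<in> \<F>)"

definition clos :: "'a set set \<Rightarrow> 'a set \<Rightarrow> 'a set" where
  "clos \<F> Y = (\<lambda>F. F \<in> \<F>) hull Y"

definition standard :: "'a set \<Rightarrow> 'a set set \<Rightarrow> bool" where
  "standard X \<F> \<longleftrightarrow> clos \<F> {} = {} \<and> (\<forall>x\<in>X. clos \<F> {x} - {x} \<in> \<F>)"

definition atomistic :: "'a set \<Rightarrow> 'a set set \<Rightarrow> bool" where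
  "atomistic X \<F> \<longleftrightarrow> (\<forall>x\<in>X. clos \<F> {x} = {x})"

(* The closed sets covering the empty set, which is the least closed set of a standard system. *)
definition atoms :: "'a set set \<Rightarrow> 'a set set" where
  "atoms \<F> = {A \<in> \<F>. A \<noteq> {} \<and> \<not> (\<exists>F\<in>\<F>. {} \<subset> F \<and> F \<subset> A)}"

definition biatomic :: "'a set set \<Rightarrow> bool" where
  "biatomic \<F> \<longleftrightarrow>
     (\<forall>F1\<in>\<F>. \<forall>F2\<in>\<F>. F1 \<noteq> {} \<longrightarrow> F2 \<noteq> {} \<longrightarrow>
       (\<forall>x. {x} \<in> atoms \<F> \<longrightarrow> x \<in> clos \<F> (F1 \<union> F2) \<longrightarrow>
         (\<exists>x1 x2. {x1} \<in> atoms \<F> \<and> {x2} \<in> atoms \<F> \<and> {x1} \<subseteq> F1 \<and> {x2} \<subseteq> F2 \<and>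
            x \<in> clos \<F> {x1, x2})))"

definition minimal_generator :: "'a set \<Rightarrow> 'a set set \<Rightarrow> 'a \<Rightarrow> 'a set \<Rightarrow> bool" where
  "minimal_generator X \<F> x A \<longleftrightarrow>
     A \<subseteq> X \<and> x \<in> clos \<F> A \<and> (\<forall>B. B \<subset> A \<longrightarrow> x \<notin> clos \<F> B)"

definition independent_set :: "'a set \<Rightarrow> 'a set set \<Rightarrow> 'a set \<Rightarrow> bool" where
  "independent_set X \<F> Y \<longleftrightarrow>
     Y \<subseteq> X \<and>
     (\<forall>Y1 Y2. Y1 \<subseteq> Y \<longrightarrow> Y2 \<subseteq> Y \<longrightarrow>
        clos \<F> (Y1 \<inter> Y2) = clos \<F> Y1 \<inter> clos \<F> Y2)"

(* For finite X the bound k = card X is admissible, so the least element exists. *)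
definition caratheodory_number :: "'a set \<Rightarrow> 'a set set \<Rightarrow> nat" where
  "caratheodory_number X \<F> =
     (LEAST k. \<forall>A x. A \<subseteq> X \<longrightarrow> x \<in> X \<longrightarrow> x \<in> clos \<F> A \<longrightarrow>
        (\<exists>A'. A' \<subseteq> A \<and> card A' \<le> k \<and> x \<in> clos \<F> A'))"

end

(* Idea: let A be a minimal generator of x.  Every non-empty B \<subseteq> A contains in its closure a point
   lying in the closure of no proper subset of B: biatomicity applied to the closures of B and
   A - B gives y in the closure of B and z in the closure of A - B with x in the closure of {y, z},
   and a smaller generator of y would yield one of x.  Independence of A makes these points
   distinct for distinct B, so 2^|A| - 1 \<le> |X|. *)
theory Submission
  imports Defs
begin

lemma clos_superset: "Y \<subseteq> clos \<F> Y"
  unfolding clos_def by (rule hull_subset)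

lemma clos_mono: "Y \<subseteq> Z \<Longrightarrow> clos \<F> Y \<subseteq> clos \<F> Z"
  unfolding clos_def by (rule hull_mono)

lemma clos_minimal: "Y \<subseteq> F \<Longrightarrow> F \<in> \<F> \<Longrightarrow> clos \<F> Y \<subseteq> F"
  unfolding clos_def by (rule hull_minimal)

text \<open>The definition of a closure system grants binary intersections only, whereas a hull
  intersects a whole family; induction over the finite family bridges the gap.\<close>

lemma closure_system_Inter:
  assumes "closure_system X \<F>" "finite \<G>" "\<G> \<noteq> {}" "\<G> \<subseteq> \<F>"
  shows "\<Inter>\<G> \<in> \<F>"
  using assms(2-4)
proof (induction rule: finite_ne_induct)
  case (insert F \<G>)
  then show ?case
    using assms(1) by (simp add: closure_system_def)
qed simp

lemma clos_closed:
  assumes "finite X" "closure_system X \<F>" "Y \<subseteq> X"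
  shows "clos \<F> Y \<in> \<F>"
proof -
  have "\<F> \<subseteq> Pow X" "X \<in> \<F>"
    using assms(2) by (auto simp: closure_system_def)
  \<comment> \<open>The hull of \<open>Y\<close> intersects exactly this family: it is finite
    because it lies in \<open>Pow X\<close>, and non-empty because it contains
    \<open>X\<close>.\<close>
  moreover from this have "finite {F. F \<in> \<F> \<and> Y \<subseteq> F}"
    using assms(1) by (auto intro: finite_subset[of _ "Pow X"])
  ultimately show ?thesis
    unfolding clos_def hull_def
    using assms(3) by (intro closure_system_Inter[OF assms(2)]) auto
qed

lemma singleton_atom:
  assumes "finite X" "closure_system X \<F>" "atomistic X \<F>" "x \<in> X"
  shows "{x} \<in> atoms \<F>"
proof -
  have "{x} \<in> \<F>"
    using clos_closed[OF assms(1,2), of "{x}"] assms(3,4) by (simp add: atomistic_def)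
  then show ?thesis
    by (auto simp: atoms_def)
qed

lemma biatomicE:
  assumes "biatomic \<F>" "F1 \<in> \<F>" "F2 \<in> \<F>" "F1 \<noteq> {}" "F2 \<noteq> {}"
    and "{x} \<in> atoms \<F>" "x \<in> clos \<F> (F1 \<union> F2)"
  obtains x1 x2 where "x1 \<in> F1" "x2 \<in> F2" "x \<in> clos \<F> {x1, x2}"
proof -
  have "\<exists>x1 x2. {x1} \<in> atoms \<F> \<and> {x2} \<in> atoms \<F> \<and> {x1} \<subseteq> F1 \<and> {x2} \<subseteq> F2 \<and>
      x \<in> clos \<F> {x1, x2}"
    using assms unfolding biatomic_def by simp
  then show thesis
    using that by blast
qed

lemma minimal_generator_exists:
  assumes "finite A" "A \<subseteq> X" "x \<in> clos \<F> A"
  obtains B where "B \<subseteq> A" "minimal_generator X \<F> x B"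
proof -
  define \<G> where "\<G> = {B. B \<subseteq> A \<and> x \<in> clos \<F> B}"
  have "finite \<G>" "A \<in> \<G>"
    using assms by (auto simp: \<G>_def)
  then obtain B where "B \<in> \<G>" and min: "\<And>C. C \<in> \<G> \<Longrightarrow> C \<subseteq> B \<Longrightarrow> B = C"
    using finite_has_minimal2[of \<G> A] by blast
  then have "B \<subseteq> A" "x \<in> clos \<F> B" "\<forall>C. C \<subset> B \<longrightarrow> x \<notin> clos \<F> C"
    by (auto simp: \<G>_def)
  with assms(2) have "minimal_generator X \<F> x B"
    unfolding minimal_generator_def by blast
  with \<open>B \<subseteq> A\<close> show thesis
    by (rule that)
qed

lemma minimal_generator_subset_witness:
  assumes "finite X" "closure_system X \<F>" "atomistic X \<F>" "biatomic \<F>"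
    and "x \<in> X" "minimal_generator X \<F> x A" "B \<subseteq> A" "B \<noteq> {}"
  obtains y where "y \<in> X" "minimal_generator X \<F> y B"
proof (cases "B = A")
  \<comment> \<open>Here \<open>A - B\<close> is empty, so its closure need not be non-empty as
    biatomicity demands; \<open>x\<close> itself is the witness.\<close>
  case True
  with assms(5,6) show thesis
    by (intro that) simp_all
next
  case False
  have A: "A \<subseteq> X" "x \<in> clos \<F> A" "\<And>C. C \<subset> A \<Longrightarrow> x \<notin> clos \<F> C"
    using assms(6) by (auto simp: minimal_generator_def)
  have closed: "clos \<F> C \<in> \<F>" if "C \<subseteq> A" for C
    using that A(1) by (intro clos_closed[OF assms(1,2)]) auto
  \<comment> \<open>Biatomicity speaks about closed sets, so the partition of \<open>A\<close> into
    \<open>B\<close> and \<open>A - B\<close> is replaced by the two closures.\<close>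
  have "A \<subseteq> clos \<F> B \<union> clos \<F> (A - B)"
    using clos_superset[of B \<F>] clos_superset[of "A - B" \<F>] by blast
  then have x: "x \<in> clos \<F> (clos \<F> B \<union> clos \<F> (A - B))"
    using A(2) clos_mono by blast
  have ne: "clos \<F> B \<noteq> {}" "clos \<F> (A - B) \<noteq> {}"
    using assms(7,8) False clos_superset[of B \<F>] clos_superset[of "A - B" \<F>] by auto
  obtain y z where yz: "y \<in> clos \<F> B" "z \<in> clos \<F> (A - B)" "x \<in> clos \<F> {y, z}"
    by (rule biatomicE[OF assms(4) closed[OF assms(7)] closed[OF Diff_subset] ne
          singleton_atom[OF assms(1-3,5)] x])
  have "y \<notin> clos \<F> C" if "C \<subset> B" for C
  proof
    assume "y \<in> clos \<F> C"
    \<comment> \<open>Swapping \<open>B\<close> for the smaller \<open>C\<close> inside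
      \<open>A\<close> gives a proper subset of \<open>A\<close>. Its closure contains both
      \<open>y\<close> and \<open>z\<close>, hence also \<open>x\<close>, against the minimality of
      \<open>A\<close>.\<close>
    let ?D = "C \<union> (A - B)"
    have D: "?D \<subset> A"
      using that assms(7) by blast
    have "y \<in> clos \<F> ?D" "z \<in> clos \<F> ?D"
      using \<open>y \<in> clos \<F> C\<close> yz(2) clos_mono[of C ?D \<F>] clos_mono[of "A - B" ?D \<F>] by auto
    then have "clos \<F> {y, z} \<subseteq> clos \<F> ?D"
      using D by (intro clos_minimal closed) auto
    with yz(3) A(3)[OF D] show False by blast
  qed
  moreover have "y \<in> X"
    using closed[OF assms(7)] assms(2) yz(1) by (auto simp: closure_system_def)
  ultimately have "minimal_generator X \<F> y B"
    using yz(1) A(1) assms(7) unfolding minimal_generator_def by blast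
  with \<open>y \<in> X\<close> show thesis
    by (rule that)
qed

lemma independent_minimal_generator_card:
  assumes "finite X" "closure_system X \<F>" "atomistic X \<F>" "biatomic \<F>"
    and "x \<in> X" "minimal_generator X \<F> x A" "independent_set X \<F> A"
  shows "2 ^ card A \<le> card X + 1"
proof -
  \<comment> \<open>Only non-empty \<open>B\<close> have a witness from the preceding lemma; leaving
    out the empty set accounts for the \<open>+ 1\<close> in the bound.\<close>
  have "\<exists>y. y \<in> X \<and> minimal_generator X \<F> y B" if "B \<in> Pow A - {{}}" for B
  proof -
    have "B \<subseteq> A" "B \<noteq> {}"
      using that by auto
    then show ?thesis
      by (rule minimal_generator_subset_witness[OF assms(1-6)]) blast
  qed
  then obtain f where f: "\<And>B. B \<in> Pow A - {{}} \<Longrightarrow> f B \<in> X \<and> minimal_generator X \<F> (f B) B"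
    by metis
  have "inj_on f (Pow A - {{}})"
  proof (rule inj_onI)
    fix B C
    assume B: "B \<in> Pow A - {{}}" and C: "C \<in> Pow A - {{}}" and eq: "f B = f C"
    have min: "minimal_generator X \<F> (f B) B" "minimal_generator X \<F> (f B) C"
      using f[OF B] f[OF C] unfolding eq by auto
    \<comment> \<open>Independence puts the common point into the closure of
      \<open>B \<inter> C\<close>. As \<open>B\<close> and \<open>C\<close> are both minimal
      generators of it, the intersection is proper in neither, so it equals both.\<close>
    have "f B \<in> clos \<F> B \<inter> clos \<F> C"
      using min unfolding minimal_generator_def by blast
    also have "\<dots> = clos \<F> (B \<inter> C)"
      using assms(7) B C by (simp add: independent_set_def)
    finally have "\<not> B \<inter> C \<subset> B" "\<not> B \<inter> C \<subset> C"
      using min unfolding minimal_generator_def by (meson, meson)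
    then show "B = C" by blast
  qed
  moreover have "f ` (Pow A - {{}}) \<subseteq> X"
    using f by blast
  ultimately have "card (Pow A - {{}}) \<le> card X"
    using assms(1) by (rule card_inj_on_le)
  moreover have "finite A"
    using assms(1,6) by (auto simp: minimal_generator_def intro: finite_subset)
  ultimately show ?thesis
    by (simp add: card_Pow)
qed

text \<open>Any \<open>A\<close> with \<open>x\<close> in its closure can be shrunk to a minimal
  generator of \<open>x\<close>, which serves as the small subset \<open>A'\<close>.\<close>

lemma caratheodory_number_le:
  assumes "finite X"
    and "\<And>x A. x \<in> X \<Longrightarrow> minimal_generator X \<F> x A \<Longrightarrow> card A \<le> k"
  shows "caratheodory_number X \<F> \<le> k"
  unfolding caratheodory_number_def
proof (rule Least_le, intro allI impI)
  fix A x
  assume A: "A \<subseteq> X" "x \<in> X" "x \<in> clos \<F> A"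
  then have "finite A"
    using assms(1) finite_subset by blast
  then obtain B where "B \<subseteq> A" "minimal_generator X \<F> x B"
    by (rule minimal_generator_exists[OF _ A(1,3)])
  moreover from this have "card B \<le> k" "x \<in> clos \<F> B"
    using assms(2)[OF A(2)] unfolding minimal_generator_def by blast+
  ultimately show "\<exists>A'. A' \<subseteq> A \<and> card A' \<le> k \<and> x \<in> clos \<F> A'"
    by blast
qed

theorem theorem4:
  fixes X :: "'a set" and \<F> :: "'a set set"
  assumes "finite X"
    and "closure_system X \<F>"
    and "standard X \<F>"
    and "atomistic X \<F>"
    and "biatomic \<F>"
    and "\<And>x A. x \<in> X \<Longrightarrow> minimal_generator X \<F> x A \<Longrightarrow> independent_set X \<F> A"
  shows "int (caratheodory_number X \<F>) \<le> \<lceil>log 2 (real (card X) + 1)\<rceil>"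
proof -
  let ?l = "log 2 (real (card X) + 1)"
  have "card A \<le> nat \<lceil>?l\<rceil>" if "x \<in> X" "minimal_generator X \<F> x A" for x A
  proof -
    have "2 ^ card A \<le> card X + 1"
      using independent_minimal_generator_card[OF assms(1,2,4,5) that] assms(6)[OF that] .
    then have "real (2 ^ card A) \<le> real (card X + 1)"
      by (simp only: of_nat_le_iff)
    then have "2 ^ card A \<le> real (card X) + 1"
      by simp
    then have "real (card A) \<le> ?l"
      by (intro le_log_of_power) auto
    then show ?thesis by linarith
  qed
  then have "caratheodory_number X \<F> \<le> nat \<lceil>?l\<rceil>"
    by (rule caratheodory_number_le[OF assms(1)])
  \<comment> \<open>Non-negativity ensures that \<open>nat\<close> does not truncate the ceiling, so
    the bound carries over to the integers.\<close>
  moreover have "0 \<le> ?l" by simp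
  ultimately show ?thesis by linarith
qed

end
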